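(* For every integer $n\ge 1$ we have $S_{\square}(n)\le\frac{n^2-1}{8}$.
   Context: For a finite set $P\subset\mathbb{R}^2$, $S_{\square}(P)$ denotes the number of squares contained in $P$, i.e. the number of $4$-element subsets of $P$ that are the vertex set of a (non-degenerate, arbitrarily oriented) square. $S_{\square}(n)$ denotes the maximum of $S_{\square}(P)$ over all subsets $P\subset\mathbb{R}^2$ of cardinality $n$. *)

theory Defs
  imports "HOL-Analysis.Analysis"
begin

text \<open>
  The vertices \<open>a\<close>, \<open>b\<close>, \<open>c\<close>, \<open>d\<close> are listed in cyclic order: a square is a parallelogram with two
  adjacent sides that are perpendicular and of the same non-zero length.
\<close>

definition is_square :: "(real^2) set \<Rightarrow> bool" where
  "is_square Q \<longleftrightarrow> (\<exists>a b c d. Q = {a, b, c, d} \<and> a \<noteq> b \<and>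
     c - b = d - a \<and> norm (d - a) = norm (b - a) \<and> (b - a) \<bullet> (d - a) = 0)"

definition squares_in :: "(real^2) set \<Rightarrow> (real^2) set set" where
  "squares_in P = {Q. Q \<subseteq> P \<and> card Q = 4 \<and> is_square Q}"

definition num_squares :: "(real^2) set \<Rightarrow> nat" where
  "num_squares P = card (squares_in P)"

definition max_squares :: "nat \<Rightarrow> nat" where
  "max_squares n = Max {num_squares P | P. finite P \<and> card P = n}"

text \<open>The maximum is taken over a finite non-empty set of numbers, hence attained.\<close>

lemma finite_num_squares_values: "finite {num_squares P | P. finite P \<and> card P = n}"
proof -
  have "num_squares P \<le> 2 ^ n" if "finite P" "card P = n" for P
  proof -
    have "squares_in P \<subseteq> Pow P"
      by (auto simp: squares_in_def)
    then have "card (squares_in P) \<le> card (Pow P)"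
      using that by (intro card_mono) auto
    then show ?thesis
      using that by (simp add: num_squares_def card_Pow)
  qed
  then have "{num_squares P | P. finite P \<and> card P = n} \<subseteq> {..2 ^ n}"
    by auto
  then show ?thesis
    by (rule finite_subset) simp
qed

lemma num_squares_values_nonempty: "{num_squares P | P. finite P \<and> card P = n} \<noteq> {}"
proof -
  have "infinite (UNIV :: (real^2) set)"
    by (rule infinite_UNIV_char_0)
  then obtain P :: "(real^2) set" where "finite P" "card P = n"
    using infinite_arbitrarily_large by blast
  then show ?thesis
    by blast
qed

end

theory Submission
  imports Defs
begin

text \<open>
  Order the plane lexicographically and look at the corners of a square. The vector \<open>u\<close> from a
  corner \<open>a\<close> to its neighbour and its quarter turn \<open>J u\<close> lie in consecutive half-open quadrants,
  and going round the square \<open>u\<close> meets each quadrant exactly once. So at two of the four corners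
  exactly one of the two neighbours precedes the corner. For a point \<open>a\<close> with \<open>l\<close>
  predecessors and \<open>r\<close> successors in \<open>P\<close>, at most \<open>min l r\<close> squares have such a corner at \<open>a\<close>,
  because either neighbour determines the square. Hence twice the number of squares is at most
  \<open>\<Sum>i<n. min i (n - 1 - i)\<close>, which is at most \<open>(n - 1)\<^sup>2 / 4\<close>.
\<close>

section \<open>Quarter turns and the lexicographic order\<close>

definition quarter_turn :: "real^2 \<Rightarrow> real^2" where
  "quarter_turn u = vector [- u$2, u$1]"

text \<open>
  Ties on the vertical axis are broken downwards, so that the first quadrant \<open>v$1 > 0\<close>, \<open>v$2 \<ge> 0\<close>
  consists of the \<open>v\<close> that are positive while \<open>quarter_turn v\<close> is not.
\<close>

definition lex_pos :: "real^2 \<Rightarrow> bool" where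
  "lex_pos v \<longleftrightarrow> v$1 > 0 \<or> (v$1 = 0 \<and> v$2 < 0)"

definition square_at :: "real^2 \<Rightarrow> real^2 \<Rightarrow> (real^2) set" where
  "square_at a u = {a, a + u, a + u + quarter_turn u, a + quarter_turn u}"

lemma quarter_turn_component [simp]:
  "quarter_turn u $ 1 = - u$2" "quarter_turn u $ 2 = u$1"
  by (simp_all add: quarter_turn_def)

lemma vec2_eq_iff: "(x :: real^2) = y \<longleftrightarrow> x$1 = y$1 \<and> x$2 = y$2"
  by (simp add: vec_eq_iff forall_2)

lemma quarter_turn_quarter_turn [simp]: "quarter_turn (quarter_turn u) = - u"
  by (simp add: vec2_eq_iff)

lemma quarter_turn_minus [simp]: "quarter_turn (- u) = - quarter_turn u"
  by (simp add: vec2_eq_iff)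

lemma quarter_turn_inject [simp]: "quarter_turn u = quarter_turn v \<longleftrightarrow> u = v"
  by (auto simp: vec2_eq_iff)

lemma quarter_turn_eq_0_iff [simp]: "quarter_turn u = 0 \<longleftrightarrow> u = 0"
  by (auto simp: vec2_eq_iff)

lemma quarter_turn_0 [simp]: "quarter_turn 0 = 0"
  by simp

text \<open>Totality and asymmetry of the order in which \<open>p\<close> precedes \<open>q\<close>
  when \<open>lex_pos (q - p)\<close>; \<open>lex_pos_add\<close> supplies transitivity.\<close>

lemma lex_pos_minus: "u \<noteq> 0 \<Longrightarrow> lex_pos (- u) \<longleftrightarrow> \<not> lex_pos u"
  by (auto simp: lex_pos_def vec2_eq_iff)

lemma lex_pos_0 [simp]: "\<not> lex_pos 0"
  by (simp add: lex_pos_def)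

lemma lex_pos_add: "lex_pos u \<Longrightarrow> lex_pos v \<Longrightarrow> lex_pos (u + v)"
  by (auto simp: lex_pos_def)

text \<open>Turning \<open>u\<close> leads to the first or second quadrant, whereas \<open>v\<close>
  lies in the third.\<close>

lemma quarter_turn_second_quadrant:
  assumes "lex_pos u" "\<not> lex_pos v" "lex_pos (quarter_turn v)"
  shows "quarter_turn u \<noteq> v"
proof
  assume "quarter_turn u = v"
  then have "quarter_turn v = - u"
    by auto
  with assms show False
    using lex_pos_minus[of u] by (cases "u = 0") auto
qed

text \<open>Turning \<open>v\<close> leads from the third quadrant to the fourth, whereas
  \<open>u\<close> is zero or lies in the first or second.\<close>

lemma quarter_turn_third_quadrant:
  assumes "\<not> lex_pos (quarter_turn u)" "\<not> lex_pos v" "lex_pos (quarter_turn v)"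
  shows "quarter_turn v \<noteq> u"
proof
  assume "quarter_turn v = u"
  then have "quarter_turn u = - v"
    by auto
  with assms show False
    using lex_pos_minus[of v] by (cases "v = 0") auto
qed

section \<open>Squares described by a corner and a side\<close>

lemma square_at_turn: "square_at (a + u) (quarter_turn u) = square_at a u"
  by (auto simp: square_at_def)

lemma perp_same_norm_cases:
  fixes v w :: "real^2"
  assumes "norm w = norm v" "v \<bullet> w = 0"
  shows "w = quarter_turn v \<or> v = quarter_turn w"
proof -
  have n: "w$1 * w$1 + w$2 * w$2 = v$1 * v$1 + v$2 * v$2"
    using assms(1) by (simp add: norm_eq inner_vec_def sum_2)
  have p: "v$1 * w$1 + v$2 * w$2 = 0"
    using assms(2) by (simp add: inner_vec_def sum_2)
  show ?thesis
  proof (cases "v = 0")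
    case True
    then show ?thesis
      using assms(1) by simp
  next
    case False
    then have pos: "v$1 * v$1 + v$2 * v$2 \<noteq> 0"
      by (simp add: vec2_eq_iff sum_squares_eq_zero_iff)
    \<comment> \<open>\<open>?d\<close> is the determinant of \<open>v\<close> and \<open>w\<close>.
      The inner product drops out of Lagrange's identity, which leaves \<open>?d\<close> equal to
      \<open>?N\<close> up to sign.\<close>
    let ?d = "v$1 * w$2 - v$2 * w$1" and ?N = "v$1 * v$1 + v$2 * v$2"
    have "?d * ?d = ?N * ?N"
      using n p by algebra
    then have d: "?d = ?N \<or> ?d = - ?N"
      by (simp add: square_eq_iff)
    \<comment> \<open>Expansion of \<open>w\<close> in the orthogonal basis \<open>v\<close>,
      \<open>quarter_turn v\<close>: by \<open>p\<close> the component along \<open>v\<close>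
      vanishes.\<close>
    have w: "?N * w$1 = ?d * (- v$2)" "?N * w$2 = ?d * v$1"
      using p by algebra+
    from d have "(w$1 = - v$2 \<and> w$2 = v$1) \<or> (w$1 = v$2 \<and> w$2 = - v$1)"
    proof
      assume "?d = ?N"
      with w have "?N * w$1 = ?N * (- v$2)" "?N * w$2 = ?N * v$1"
        by simp_all
      then show ?thesis
        unfolding mult_left_cancel[OF pos] by blast
    next
      assume "?d = - ?N"
      with w have "?N * w$1 = ?N * v$2" "?N * w$2 = ?N * (- v$1)"
        by (simp_all only: minus_mult_minus minus_mult_commute)
      then show ?thesis
        unfolding mult_left_cancel[OF pos] by blast
    qed
    then show ?thesis
      by (auto simp: vec2_eq_iff)
  qed
qed

lemma is_square_imp_square_at:
  assumes "is_square Q"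
  obtains a u where "u \<noteq> 0" "Q = square_at a u"
proof -
  from assms obtain a b c d where Q: "Q = {a, b, c, d}" and ab: "a \<noteq> b"
    and c: "c - b = d - a" and nm: "norm (d - a) = norm (b - a)" and p: "(b - a) \<bullet> (d - a) = 0"
    unfolding is_square_def by blast
  have ad: "a \<noteq> d"
    using nm ab by auto
  have c': "c = b + (d - a)"
    using c by (simp add: algebra_simps)
  from perp_same_norm_cases[OF nm p] show ?thesis
  proof
    assume t: "d - a = quarter_turn (b - a)"
    have "Q = square_at a (b - a)"
      unfolding square_at_def t[symmetric] Q c' by simp
    with ab show ?thesis
      by (intro that[of "b - a" a]) auto
  next
    assume t: "b - a = quarter_turn (d - a)"
    have "Q = square_at a (d - a)"
      unfolding square_at_def t[symmetric] Q c' by (auto simp: algebra_simps)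
    with ad show ?thesis
      by (intro that[of "d - a" a]) auto
  qed
qed

text \<open>Seen from its successive corners the square has sides \<open>u\<close>,
  \<open>quarter_turn u\<close> and their negatives; the signs of the first two tell which of the
  four lies in the first quadrant.\<close>

lemma square_at_first_quadrant:
  assumes "u \<noteq> 0"
  obtains b v where "lex_pos v" "\<not> lex_pos (quarter_turn v)" "square_at a u = square_at b v"
proof -
  let ?J = quarter_turn
  have e: "square_at a u = square_at (a + u) (?J u)"
    "square_at a u = square_at (a + u + ?J u) (- u)"
    "square_at a u = square_at (a + u + ?J u + - u) (- ?J u)"
    using square_at_turn[of a u] square_at_turn[of "a + u" "?J u"]
      square_at_turn[of "a + u + ?J u" "- u"] by simp_all
  have m: "lex_pos (- u) \<longleftrightarrow> \<not> lex_pos u" "lex_pos (- ?J u) \<longleftrightarrow> \<not> lex_pos (?J u)"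
    using assms by (simp_all add: lex_pos_minus)
  consider "lex_pos u" "\<not> lex_pos (?J u)" | "lex_pos (?J u)" "lex_pos u"
    | "\<not> lex_pos u" "lex_pos (?J u)" | "\<not> lex_pos u" "\<not> lex_pos (?J u)"
    by blast
  then show ?thesis
  proof cases
    case 1
    then show ?thesis using that by blast
  next
    case 2
    then show ?thesis using that[OF _ _ e(1)] m by simp
  next
    case 3
    then show ?thesis using that[OF _ _ e(2)] m by simp
  next
    case 4
    then show ?thesis using that[OF _ _ e(3)] m by simp
  qed
qed

section \<open>Counting corners with one neighbour on each side\<close>

text \<open>Since \<open>quarter_turn\<close> is counterclockwise, a square with corner
  \<open>a\<close> arises from only one \<open>u\<close>. The sign condition puts \<open>u\<close>
  in the first or third quadrant and excludes \<open>u = 0\<close>.\<close>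

definition split_corners :: "(real^2) set \<Rightarrow> (real^2) \<Rightarrow> (real^2) set" where
  "split_corners P a = {u. square_at a u \<subseteq> P \<and> lex_pos u \<noteq> lex_pos (quarter_turn u)}"

lemma finite_split_corners:
  assumes "finite P"
  shows "finite (split_corners P a)"
proof (rule finite_subset)
  show "split_corners P a \<subseteq> (\<lambda>p. p - a) ` P"
  proof
    fix u assume "u \<in> split_corners P a"
    then have "a + u \<in> P"
      by (simp add: split_corners_def square_at_def)
    then show "u \<in> (\<lambda>p. p - a) ` P"
      by (intro image_eqI[of _ _ "a + u"]) auto
  qed
qed (use assms in simp)

text \<open>The map \<open>?f\<close> picks the neighbour that follows \<open>a\<close>. For sides
  of opposite sign the two displacements lie in the first and the fourth quadrant, so they
  differ.\<close>

lemma card_split_corners_le_above: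
  assumes "finite P"
  shows "card (split_corners P a) \<le> card {p \<in> P. lex_pos (p - a)}"
proof (rule card_inj_on_le)
  let ?f = "\<lambda>u. a + (if lex_pos u then u else quarter_turn u)"
  show "inj_on ?f (split_corners P a)"
  proof (rule inj_onI)
    fix u v assume uv: "u \<in> split_corners P a" "v \<in> split_corners P a" "?f u = ?f v"
    show "u = v"
    proof (cases "lex_pos u \<longleftrightarrow> lex_pos v")
      case True
      with uv(3) show ?thesis by (auto split: if_splits)
    next
      case False
      with uv show ?thesis
        using quarter_turn_third_quadrant[of u v] quarter_turn_third_quadrant[of v u]
        by (auto simp: split_corners_def split: if_splits)
    qed
  qed
  show "?f ` split_corners P a \<subseteq> {p \<in> P. lex_pos (p - a)}"
    by (auto simp: split_corners_def square_at_def)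
qed (use assms in simp)

text \<open>The same with the neighbour that precedes \<open>a\<close>; now the displacements lie in
  the second and the third quadrant.\<close>

lemma card_split_corners_le_below:
  assumes "finite P"
  shows "card (split_corners P a) \<le> card {p \<in> P. lex_pos (a - p)}"
proof (rule card_inj_on_le)
  let ?f = "\<lambda>u. a + (if lex_pos u then quarter_turn u else u)"
  have nz: "u \<noteq> 0" if "u \<in> split_corners P a" for u
    using that by (auto simp: split_corners_def)
  show "inj_on ?f (split_corners P a)"
  proof (rule inj_onI)
    fix u v assume uv: "u \<in> split_corners P a" "v \<in> split_corners P a" "?f u = ?f v"
    show "u = v"
    proof (cases "lex_pos u \<longleftrightarrow> lex_pos v")
      case True
      with uv(3) show ?thesis by (auto split: if_splits)
    next
      case False
      with uv show ?thesis
        using quarter_turn_second_quadrant[of u v] quarter_turn_second_quadrant[of v u]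
        by (auto simp: split_corners_def split: if_splits)
    qed
  qed
  show "?f ` split_corners P a \<subseteq> {p \<in> P. lex_pos (a - p)}"
    using nz by (auto simp: split_corners_def square_at_def lex_pos_minus)
qed (use assms in simp)

text \<open>Each square is reached once from \<open>?T1\<close> and once from \<open>?T2\<close>, by
  way of two opposite corners.\<close>

lemma twice_num_squares_le_split_corners:
  assumes "finite P"
  shows "2 * num_squares P \<le> (\<Sum>a\<in>P. card (split_corners P a))"
proof -
  let ?J = quarter_turn
  let ?T = "Sigma P (split_corners P)"
  let ?T1 = "{(a, u) \<in> ?T. lex_pos u}" and ?T2 = "{(a, u) \<in> ?T. \<not> lex_pos u}"
  have fin: "finite ?T"
    using assms finite_split_corners by auto
  have fin12: "finite ?T1" "finite ?T2"
    by (rule finite_subset[OF _ fin]; auto)+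
  have "squares_in P \<subseteq> (\<lambda>(a, u). square_at a u) ` ?T1 \<inter> (\<lambda>(a, u). square_at a u) ` ?T2"
  proof
    fix Q assume "Q \<in> squares_in P"
    then have QP: "Q \<subseteq> P" and "is_square Q"
      by (auto simp: squares_in_def)
    then obtain a u where "u \<noteq> 0" "Q = square_at a u"
      using is_square_imp_square_at by blast
    then obtain b v where v: "lex_pos v" "\<not> lex_pos (?J v)" "Q = square_at b v"
      using square_at_first_quadrant by metis
    then have nz: "v \<noteq> 0"
      by auto
    \<comment> \<open>Two turns lead to the corner opposite \<open>b\<close>, where the side is
      reversed and lies in the third quadrant.\<close>
    have Q': "Q = square_at (b + v + ?J v) (- v)"
      using v(3) square_at_turn[of b v] square_at_turn[of "b + v" "?J v"] by simp
    have "(b, v) \<in> ?T1"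
      using v QP by (auto simp: split_corners_def square_at_def)
    moreover have "(b + v + ?J v, - v) \<in> ?T2"
      using v(1,2) nz QP Q' by (auto simp: split_corners_def square_at_def lex_pos_minus)
    ultimately show "Q \<in> (\<lambda>(a, u). square_at a u) ` ?T1 \<inter> (\<lambda>(a, u). square_at a u) ` ?T2"
      using v(3) Q' by (metis (no_types, lifting) IntI case_prod_conv image_eqI)
  qed
  then have "num_squares P \<le> card ?T1" "num_squares P \<le> card ?T2"
    unfolding num_squares_def using fin12 by (auto intro: surj_card_le)
  then have "2 * num_squares P \<le> card ?T1 + card ?T2"
    by simp
  also have "\<dots> = card (?T1 \<union> ?T2)"
    using fin12 by (intro card_Un_disjoint[symmetric]) auto
  also have "?T1 \<union> ?T2 = ?T"
    by auto
  also have "card ?T = (\<Sum>a\<in>P. card (split_corners P a))"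
    using assms finite_split_corners by (intro card_SigmaI) auto
  finally show ?thesis .
qed

text \<open>From \<open>m\<close> to \<open>m + 2\<close> the sum gains two zero end terms and each
  of the \<open>m + 1\<close> inner terms grows by 1, while \<open>4 * (m + 1)\<close> is the
  difference of the squares.\<close>

lemma sum_min_rank: "4 * (\<Sum>i\<le>m. min i (m - i)) \<le> (m\<^sup>2 :: nat)"
proof (induction m rule: nat_induct2)
  case (step m)
  have "(\<Sum>i\<le>m + 2. min i (m + 2 - i)) = (\<Sum>i\<le>Suc m. min (Suc i) (Suc m - i))"
    using sum.atMost_Suc_shift[of "\<lambda>i. min i (m + 2 - i)" "Suc m"] by simp
  also have "\<dots> = (\<Sum>i\<le>m. min (Suc i) (Suc m - i))"
    by simp
  also have "\<dots> = (\<Sum>i\<le>m. Suc (min i (m - i)))"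
    by (intro sum.cong) (auto simp: Suc_diff_le)
  also have "\<dots> = (m + 1) + (\<Sum>i\<le>m. min i (m - i))"
    by (simp add: sum_Suc)
  finally show ?case
    using step by (simp add: power2_eq_square algebra_simps)
qed auto

lemma num_squares_le:
  assumes "finite P" "card P = Suc m"
  shows "8 * num_squares P \<le> m\<^sup>2"
proof -
  let ?r = "\<lambda>a. card {p \<in> P. lex_pos (p - a)}" and ?l = "\<lambda>a. card {p \<in> P. lex_pos (a - p)}"
  have lr: "?l a + ?r a = m" if "a \<in> P" for a
  proof -
    have "P - {a} = {p \<in> P. lex_pos (a - p)} \<union> {p \<in> P. lex_pos (p - a)}"
      using lex_pos_minus[of "_ - a"] by force
    moreover have "{p \<in> P. lex_pos (a - p)} \<inter> {p \<in> P. lex_pos (p - a)} = {}"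
      using lex_pos_add[of "a - _" "_ - a"] by force
    ultimately have "?l a + ?r a = card (P - {a})"
      using assms(1) by (simp add: card_Un_disjoint)
    with assms that show ?thesis by simp
  qed
  have less: "?r b < ?r a" if "a \<in> P" "b \<in> P" "lex_pos (b - a)" for a b
  proof (rule psubset_card_mono)
    have "{p \<in> P. lex_pos (p - b)} \<subseteq> {p \<in> P. lex_pos (p - a)}"
      using lex_pos_add[OF that(3)] by force
    moreover have "b \<in> {p \<in> P. lex_pos (p - a)} - {p \<in> P. lex_pos (p - b)}"
      using that by simp
    ultimately show "{p \<in> P. lex_pos (p - b)} \<subset> {p \<in> P. lex_pos (p - a)}"
      by blast
  qed (use assms in simp)
  have inj: "inj_on ?r P"
  proof (rule inj_onI)
    fix a b assume ab: "a \<in> P" "b \<in> P" "?r a = ?r b"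
    show "a = b"
    proof (rule ccontr)
      assume "a \<noteq> b"
      then have "lex_pos (b - a) \<or> lex_pos (a - b)"
        using lex_pos_minus[of "a - b"] by auto
      with less ab show False by fastforce
    qed
  qed
  \<comment> \<open>An injective map from \<open>m + 1\<close> points into \<open>{..m}\<close>
    takes every value once, so the sum over \<open>P\<close> becomes a sum over ranks.\<close>
  have img: "?r ` P = {..m}"
  proof (rule card_subset_eq)
    show "?r ` P \<subseteq> {..m}"
      using lr by fastforce
    show "card (?r ` P) = card {..m}"
      using inj assms by (simp add: card_image)
  qed simp
  have "2 * num_squares P \<le> (\<Sum>a\<in>P. card (split_corners P a))"
    using assms(1) by (rule twice_num_squares_le_split_corners)
  also have "\<dots> \<le> (\<Sum>a\<in>P. min (?r a) (m - ?r a))"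
  proof (rule sum_mono)
    fix a assume "a \<in> P"
    then have "?l a = m - ?r a"
      using lr[of a] by simp
    then show "card (split_corners P a) \<le> min (?r a) (m - ?r a)"
      using card_split_corners_le_above[OF assms(1), of a]
        card_split_corners_le_below[OF assms(1), of a] by simp
  qed
  also have "\<dots> = (\<Sum>i\<in>?r ` P. min i (m - i))"
    using inj by (simp add: sum.reindex)
  also have "\<dots> = (\<Sum>i\<le>m. min i (m - i))"
    by (simp add: img)
  finally show ?thesis
    using sum_min_rank[of m] by linarith
qed

theorem proposition35:
  fixes n :: nat
  assumes "n \<ge> 1"
  shows "real (max_squares n) \<le> ((real n)\<^sup>2 - 1) / 8"
proof -
  obtain m where n: "n = Suc m"
    using assms by (cases n) auto
  have "max_squares n \<in> {num_squares P | P. finite P \<and> card P = n}"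
    unfolding max_squares_def
    by (rule Max_in[OF finite_num_squares_values num_squares_values_nonempty])
  then have "8 * max_squares n \<le> m\<^sup>2"
    using num_squares_le n by auto
  then have "8 * real (max_squares n) \<le> (real m)\<^sup>2"
    by (metis of_nat_le_iff of_nat_mult of_nat_numeral of_nat_power)
  \<comment> \<open>As \<open>n = m + 1\<close>, the right-hand side is
    \<open>m\<^sup>2 + 2 * m\<close>.\<close>
  also have "\<dots> \<le> (real n)\<^sup>2 - 1"
    by (simp add: n power2_eq_square algebra_simps)
  finally show ?thesis
    by simp
qed

end
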